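(* Let $(X,d)$ be a complete metric space and let $T:X\to X$ be a self-mapping. Suppose that there exist two altering distance functions $\psi$ and $\varphi$ such that $$\psi(d(Tx,Ty))\le\psi(d(x,y))-\varphi(d(x,y))\quad\text{for all } x,y\in X.$$ Then there exists a pair of shifting distance functions $(\tilde\psi,\phi)$, with $\tilde\psi,\phi:[0,+\infty)\to\mathbb{R}$, such that $$\tilde\psi(d(Tx,Ty))\le\phi(d(x,y))\quad\text{for all } x,y\in X.$$
   Context: A function $\psi:[0,\infty)\to[0,\infty)$ is called an altering distance function if (1) $\psi(t)=0$ if and only if $t=0$, and (2) $\psi$ is continuous and nondecreasing. Let $\psi,\phi:[0,+\infty)\to\mathbb{R}$ be two functions. The pair $(\psi,\phi)$ is called a pair of shifting distance functions if both of the following conditions hold: (i) for all $u,v\in[0,+\infty)$, if $\psi(u)\le\phi(v)$, then $u\le v$; (ii) for all sequences $\{u_n\}_{n\ge 0},\{v_n\}_{n\ge 0}\subset[0,+\infty)$ with $\lim_{n\to\infty}u_n=\lim_{n\to\infty}v_n=w$, if $\psi(u_n)\le\phi(v_n)$ for all $n\ge 0$, then $w=0$. *)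

theory Defs
  imports "HOL-Analysis.Analysis"
begin

text \<open>Functions on \<open>[0,\<infinity>)\<close> are rendered as functions on \<^typ>\<open>real\<close> of which only the
  values on \<open>{0..}\<close> are constrained or used.\<close>

definition altering_distance :: "(real \<Rightarrow> real) \<Rightarrow> bool" where
  "altering_distance \<psi> \<longleftrightarrow>
     \<psi> \<in> {0..} \<rightarrow> {0..} \<and>
     (\<forall>t\<ge>0. \<psi> t = 0 \<longleftrightarrow> t = 0) \<and>
     continuous_on {0..} \<psi> \<and>
     mono_on {0..} \<psi>"

definition shifting_distance_pair :: "(real \<Rightarrow> real) \<Rightarrow> (real \<Rightarrow> real) \<Rightarrow> bool" where
  "shifting_distance_pair \<psi> \<phi> \<longleftrightarrow>
     (\<forall>u\<ge>0. \<forall>v\<ge>0. \<psi> u \<le> \<phi> v \<longrightarrow> u \<le> v) \<and>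
     (\<forall>(u :: nat \<Rightarrow> real) (v :: nat \<Rightarrow> real) w.
        (\<forall>n. 0 \<le> u n) \<longrightarrow> (\<forall>n. 0 \<le> v n) \<longrightarrow>
        u \<longlonglongrightarrow> w \<longrightarrow> v \<longlonglongrightarrow> w \<longrightarrow>
        (\<forall>n. \<psi> (u n) \<le> \<phi> (v n)) \<longrightarrow> w = 0)"

end

theory Submission imports Defs begin

text \<open>Keep \<open>\<psi>\<close> and take the whole right-hand side
  \<open>\<psi> - \<phi>\<close> as the second function: the contraction inequality is then already
  in the required form, and what remains is a fact about real functions, independent of the metric
  space. An inequality \<open>\<psi> u \<le> \<psi> v - \<phi> v\<close> with \<open>v < u\<close>
  squeezes \<open>\<phi> v\<close> to 0 by monotonicity of \<open>\<psi>\<close>, and vanishing only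
  at 0 then collapses both points to 0. For sequences with a common limit \<open>w\<close>,
  continuity turns the inequalities into \<open>\<psi> w \<le> \<psi> w - \<phi> w\<close>, so again
  \<open>\<phi> w = 0\<close>.\<close>

lemma shifting_distance_pair_altering_distance:
  assumes \<psi>: "altering_distance \<psi>" and \<phi>: "altering_distance \<phi>"
  shows "shifting_distance_pair \<psi> (\<lambda>t. \<psi> t - \<phi> t)"
  unfolding shifting_distance_pair_def
proof (intro conjI allI impI)
  fix u v :: real
  assume "u \<ge> 0" "v \<ge> 0" and le: "\<psi> u \<le> \<psi> v - \<phi> v"
  show "u \<le> v"
  proof (rule ccontr)
    assume "\<not> u \<le> v"
    \<comment> \<open>Since \<open>\<psi>\<close> need not be strictly increasing, this alone does
      not contradict \<open>le\<close>; it only forces \<open>\<phi> v = 0\<close>. The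
      contradiction comes from \<open>v = 0\<close>, where \<open>le\<close> reads
      \<open>\<psi> u \<le> 0\<close>.\<close>
    then have "\<psi> v \<le> \<psi> u"
      using \<psi> \<open>u \<ge> 0\<close> \<open>v \<ge> 0\<close> by (auto simp: altering_distance_def intro: mono_onD)
    moreover have "\<phi> v \<ge> 0"
      using \<phi> \<open>v \<ge> 0\<close> by (auto simp: altering_distance_def)
    ultimately have "\<phi> v = 0"
      using le by linarith
    then have "v = 0"
      using \<phi> \<open>v \<ge> 0\<close> by (auto simp: altering_distance_def)
    moreover have "\<psi> 0 = 0" "\<psi> u \<ge> 0"
      using \<psi> \<open>u \<ge> 0\<close> by (auto simp: altering_distance_def)
    ultimately have "\<psi> u = 0"
      using le \<open>\<phi> v = 0\<close> by simp
    then have "u = 0"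
      using \<psi> \<open>u \<ge> 0\<close> by (auto simp: altering_distance_def)
    with \<open>\<not> u \<le> v\<close> \<open>v \<ge> 0\<close> show False by simp
  qed
next
  fix u v :: "nat \<Rightarrow> real" and w
  assume nonneg: "\<forall>n. 0 \<le> u n" "\<forall>n. 0 \<le> v n"
    and lim: "u \<longlonglongrightarrow> w" "v \<longlonglongrightarrow> w"
    and le: "\<forall>n. \<psi> (u n) \<le> \<psi> (v n) - \<phi> (v n)"
  have "w \<ge> 0"
    using lim(1) nonneg(1) by (auto intro: LIMSEQ_le_const)
  \<comment> \<open>Continuity is only given on \<open>{0..}\<close>, so both the terms and the
    limit must be known to lie there.\<close>
  have cont: "(\<lambda>n. f (x n)) \<longlonglongrightarrow> f w"
    if "altering_distance f" "x \<longlonglongrightarrow> w" "\<forall>n. 0 \<le> x n" for f x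
    using that \<open>w \<ge> 0\<close>
    by (intro continuous_on_tendsto_compose[of "{0..}" f]) (auto simp: altering_distance_def)
  have "\<psi> w \<le> \<psi> w - \<phi> w"
  proof (rule LIMSEQ_le)
    show "(\<lambda>n. \<psi> (u n)) \<longlonglongrightarrow> \<psi> w"
      using cont \<psi> lim nonneg by blast
    show "(\<lambda>n. \<psi> (v n) - \<phi> (v n)) \<longlonglongrightarrow> \<psi> w - \<phi> w"
      using cont \<psi> \<phi> lim nonneg by (intro tendsto_diff) blast+
  qed (use le in blast)
  moreover have "\<phi> w \<ge> 0"
    using \<phi> \<open>w \<ge> 0\<close> by (auto simp: altering_distance_def)
  ultimately have "\<phi> w = 0" by simp
  then show "w = 0"
    using \<phi> \<open>w \<ge> 0\<close> by (auto simp: altering_distance_def)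
qed

theorem proposition9:
  fixes X :: "'a set" and d :: "'a \<Rightarrow> 'a \<Rightarrow> real" and T :: "'a \<Rightarrow> 'a"
    and \<psi> \<phi> :: "real \<Rightarrow> real"
  assumes "Metric_space X d" and "Metric_space.mcomplete X d"
    and "T \<in> X \<rightarrow> X"
    and "altering_distance \<psi>" and "altering_distance \<phi>"
    and "\<forall>x\<in>X. \<forall>y\<in>X. \<psi> (d (T x) (T y)) \<le> \<psi> (d x y) - \<phi> (d x y)"
  shows "\<exists>\<psi>' \<phi>'. shifting_distance_pair \<psi>' \<phi>' \<and>
           (\<forall>x\<in>X. \<forall>y\<in>X. \<psi>' (d (T x) (T y)) \<le> \<phi>' (d x y))"
  \<comment> \<open>The witnesses are \<open>\<psi>\<close> and
    \<open>\<lambda>t. \<psi> t - \<phi> t\<close>.\<close>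
  using shifting_distance_pair_altering_distance[OF assms(4,5)] assms(6) by blast

end
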